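(* Let $k\ge 0$ be an integer, and let $\mathcal{F}$ be a class of probability measures on $\mathbb{N}_0$ that contains all distributions with finite support. Then any scoring function $S:\mathbb{N}_0\times\mathbb{N}_0\to\mathbb{R}$ that is strictly consistent for the functional $l_k$ relative to $\mathcal{F}$ is equivalent to the $k$-zero-one-loss \[ (x,y)\mapsto -\mathbb{1}\{x\le y\le x+k\}. \]
   Context: Here $\mathbb{N}_0=\{0,1,2,\dots\}$. The functional $l_k:\mathcal{F}\to 2^{\mathbb{N}_0}$ gives the lower endpoints of the modal intervals $[x,x+k]$ of length $k$: \[ l_k(F)=\arg\max_{x\in\mathbb{N}_0}\ \mathbb{P}_F(x\le Y\le x+k), \] where $Y\sim F$ under $\mathbb{P}_F$. The action domain is $\mathbb{N}_0$. A function $h:\mathbb{N}_0\to\mathbb{R}$ is $\mathcal{F}$-integrable if $\mathbb{E}_F h(Y)$ is well-defined and finite for all $F\in\mathcal{F}$. A scoring function is a map $S:\mathbb{N}_0\times\mathbb{N}_0\to\mathbb{R}$ such that $S(x,\cdot)$ is $\mathcal{F}$-integrable for all $x\in\mathbb{N}_0$. It is strictly consistent for a functional $T:\mathcal{F}\to 2^{\mathbb{N}_0}$ relative to $\mathcal{F}$ if $\mathbb{E}_F S(t,Y)\le\mathbb{E}_F S(x,Y)$ for all $F\in\mathcal{F}$, $t\in T(F)$, $x\in\mathbb{N}_0$, with equality only if $x\in T(F)$. Scoring functions $S,S'$ are equivalent if $S'(x,y)=c\,S(x,y)+h(y)$ for all $x,y$, for some $c>0$ and some $\mathcal{F}$-integrable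 function $h:\mathbb{N}_0\to\mathbb{R}$. *)

theory Defs
  imports "HOL-Probability.Probability"
begin

text \<open>
  A probability measure on the natural numbers with the full power set as sigma-algebra is
  the same thing as an element of \<^typ>\<open>nat pmf\<close>, so a class of such measures is a
  \<^typ>\<open>nat pmf set\<close>.
\<close>

definition modal_interval :: "nat \<Rightarrow> nat pmf \<Rightarrow> nat set" where
  "modal_interval k F =
     {x. is_arg_max (\<lambda>x. measure_pmf.prob F {y. x \<le> y \<and> y \<le> x + k}) (\<lambda>_. True) x}"

definition class_integrable :: "nat pmf set \<Rightarrow> (nat \<Rightarrow> real) \<Rightarrow> bool" where
  "class_integrable \<F> h \<longleftrightarrow> (\<forall>F\<in>\<F>. integrable (measure_pmf F) h)"

definition scoring_function :: "nat pmf set \<Rightarrow> (nat \<Rightarrow> nat \<Rightarrow> real) \<Rightarrow> bool" where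
  "scoring_function \<F> S \<longleftrightarrow> (\<forall>x. class_integrable \<F> (S x))"

definition strictly_consistent ::
  "nat pmf set \<Rightarrow> (nat pmf \<Rightarrow> nat set) \<Rightarrow> (nat \<Rightarrow> nat \<Rightarrow> real) \<Rightarrow> bool" where
  "strictly_consistent \<F> T S \<longleftrightarrow>
     (\<forall>F\<in>\<F>. \<forall>t\<in>T F. \<forall>x.
        measure_pmf.expectation F (S t) \<le> measure_pmf.expectation F (S x) \<and>
        (measure_pmf.expectation F (S t) = measure_pmf.expectation F (S x) \<longrightarrow> x \<in> T F))"

definition equivalent_scores ::
  "nat pmf set \<Rightarrow> (nat \<Rightarrow> nat \<Rightarrow> real) \<Rightarrow> (nat \<Rightarrow> nat \<Rightarrow> real) \<Rightarrow> bool" where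
  "equivalent_scores \<F> S S' \<longleftrightarrow>
     (\<exists>c>0. \<exists>h. class_integrable \<F> h \<and> (\<forall>x y. S' x y = c * S x y + h y))"

definition zero_one_loss :: "nat \<Rightarrow> nat \<Rightarrow> nat \<Rightarrow> real" where
  "zero_one_loss k x y = - of_bool (x \<le> y \<and> y \<le> x + k)"

end

theory Submission
  imports Defs
begin

text \<open>
  Strict consistency turns a tie between two modal intervals under \<open>F\<close> into equality of the
  expected scores. It suffices to use uniform distributions on sets whose points are more than
  \<open>k\<close> apart: every interval of length \<open>k\<close> meets such a set in at most one point, so each
  interval meeting it is modal. The resulting linear equations show that \<open>S (x + 1) - S x\<close> is
  \<open>c x\<close> times the difference of the indicators of the points \<open>x\<close> and \<open>x + k + 1\<close>; the
  Dirac measure at \<open>x\<close> gives \<open>c x > 0\<close>, and the two-point set \<open>{x, x + k + 2}\<close>, under which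
  both \<open>x\<close> and \<open>x + 2\<close> are modal, gives \<open>c x = c (x + 1)\<close>.
\<close>

definition spaced :: "nat \<Rightarrow> nat set \<Rightarrow> bool" where
  "spaced k A \<longleftrightarrow> finite A \<and> A \<noteq> {} \<and> (\<forall>a\<in>A. \<forall>b\<in>A. a < b \<longrightarrow> a + k < b)"

lemma prob_pmf_of_spaced:
  assumes "spaced k A"
  shows "measure_pmf.prob (pmf_of_set A) {y. x \<le> y \<and> y \<le> x + k} =
    (if \<exists>a\<in>A. x \<le> a \<and> a \<le> x + k then 1 / card A else 0)"
proof -
  have A: "finite A" "A \<noteq> {}" and sp: "\<And>a b. a \<in> A \<Longrightarrow> b \<in> A \<Longrightarrow> a < b \<Longrightarrow> a + k < b"
    using assms unfolding spaced_def by blast+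
  have prob: "measure_pmf.prob (pmf_of_set A) {y. x \<le> y \<and> y \<le> x + k} =
      card (A \<inter> {y. x \<le> y \<and> y \<le> x + k}) / card A"
    by (rule measure_pmf_of_set[OF A(2,1)])
  show ?thesis
  proof (cases "\<exists>a\<in>A. x \<le> a \<and> a \<le> x + k")
    case True
    then obtain a where a: "a \<in> A" "x \<le> a" "a \<le> x + k" by blast
    have "b = a" if "b \<in> A" "x \<le> b" "b \<le> x + k" for b
      using sp[of a b] sp[of b a] that a by (cases a b rule: linorder_cases) auto
    then have "A \<inter> {y. x \<le> y \<and> y \<le> x + k} = {a}" using a by blast
    with True show ?thesis unfolding prob by simp
  next
    case False
    then have "A \<inter> {y. x \<le> y \<and> y \<le> x + k} = {}" by blast
    then show ?thesis unfolding prob if_not_P[OF False] by simp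
  qed
qed

lemma modal_interval_pmf_of_spaced:
  assumes "spaced k A"
  shows "x \<in> modal_interval k (pmf_of_set A) \<longleftrightarrow> (\<exists>a\<in>A. x \<le> a \<and> a \<le> x + k)"
proof -
  have A: "finite A" "A \<noteq> {}" using assms unfolding spaced_def by blast+
  then have pos: "0 < 1 / real (card A)" by (simp add: card_gt_0_iff)
  \<comment> \<open>The interval starting at a point of \<open>A\<close> attains the positive value,
    so an interval that misses \<open>A\<close> cannot be modal.\<close>
  obtain a where "a \<in> A" using A by blast
  then have "\<exists>b\<in>A. a \<le> b \<and> b \<le> a + k" by auto
  with pos show ?thesis
    unfolding modal_interval_def is_arg_max_def prob_pmf_of_spaced[OF assms]
    by (auto simp: not_less)
qed

text \<open>Both lower endpoints are modal for the uniform distribution on \<open>A\<close>, so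
  consistency applies in both directions; the common factor \<open>1 / card A\<close>
  cancels.\<close>

lemma sum_score_eq:
  assumes fin: "\<And>F :: nat pmf. finite (set_pmf F) \<Longrightarrow> F \<in> \<F>"
    and sc: "strictly_consistent \<F> (modal_interval k) S"
    and A: "spaced k A"
    and s: "\<exists>a\<in>A. s \<le> a \<and> a \<le> s + k" and t: "\<exists>a\<in>A. t \<le> a \<and> a \<le> t + k"
  shows "sum (S s) A = sum (S t) A"
proof -
  have A': "finite A" "A \<noteq> {}" using A unfolding spaced_def by blast+
  have "pmf_of_set A \<in> \<F>" using A' by (intro fin) simp
  moreover have "s \<in> modal_interval k (pmf_of_set A)" "t \<in> modal_interval k (pmf_of_set A)"
    using s t modal_interval_pmf_of_spaced[OF A] by blast+
  ultimately have "measure_pmf.expectation (pmf_of_set A) (S s) =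
      measure_pmf.expectation (pmf_of_set A) (S t)"
    using sc unfolding strictly_consistent_def by (meson antisym)
  with A' show ?thesis by (simp add: integral_pmf_of_set card_gt_0_iff)
qed

text \<open>Under the Dirac measure at \<open>a\<close> only \<open>s\<close> is modal, and
  strictness excludes a tie. This is where the sign of the scaling constant comes from.\<close>

lemma score_less:
  assumes fin: "\<And>F :: nat pmf. finite (set_pmf F) \<Longrightarrow> F \<in> \<F>"
    and sc: "strictly_consistent \<F> (modal_interval k) S"
    and s: "s \<le> a" "a \<le> s + k" and t: "\<not> (t \<le> a \<and> a \<le> t + k)"
  shows "S s a < S t a"
proof -
  have sp: "spaced k {a}" by (simp add: spaced_def)
  have "pmf_of_set {a} \<in> \<F>" by (intro fin) simp
  moreover have "s \<in> modal_interval k (pmf_of_set {a})" "t \<notin> modal_interval k (pmf_of_set {a})"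
    using s t modal_interval_pmf_of_spaced[OF sp] by auto
  ultimately have "measure_pmf.expectation (pmf_of_set {a}) (S s) <
      measure_pmf.expectation (pmf_of_set {a}) (S t)"
    using sc unfolding strictly_consistent_def by (meson order_le_imp_less_or_eq)
  then show ?thesis by (simp add: integral_pmf_of_set)
qed

theorem theorem3p9:
  fixes k :: nat and \<F> :: "nat pmf set" and S :: "nat \<Rightarrow> nat \<Rightarrow> real"
  assumes "\<And>F :: nat pmf. finite (set_pmf F) \<Longrightarrow> F \<in> \<F>"
    and "scoring_function \<F> S"
    and "strictly_consistent \<F> (modal_interval k) S"
  shows "equivalent_scores \<F> S (zero_one_loss k)"
proof -
  note tie = sum_score_eq[OF assms(1,3)]
  define c where "c x = S (Suc x) x - S x x" for x
  have c_pos: "0 < c x" for x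
    using score_less[OF assms(1,3), of x x "Suc x"] by (simp add: c_def)
  \<comment> \<open>Each of the two intervals catches exactly one of these two points, so the
    increments of \<open>S\<close> at them cancel.\<close>
  have ends: "S (Suc x) (x + k + 1) - S x (x + k + 1) = - c x" for x
    using tie[of "{x, x + k + 1}" x "Suc x"] by (simp add: spaced_def c_def)
  have inner: "S (Suc x) y = S x y" if "x < y" "y \<le> x + k" for x y
    using tie[of "{y}" x "Suc x"] that by (simp add: spaced_def)
  \<comment> \<open>Adjoin \<open>y\<close> to a set that meets both intervals and on which the
    increments already sum to zero. For \<open>k = 0\<close> the intervals are disjoint, so both
    \<open>x\<close> and \<open>Suc x\<close> are needed; otherwise one common point
    suffices.\<close>
  have outer: "S (Suc x) y = S x y" if y: "y < x \<or> x + k + 1 < y" for x y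
  proof (cases "k = 0")
    case True
    have "sum (S x) {x, Suc x, y} = sum (S (Suc x)) {x, Suc x, y}"
      using y True by (intro tie) (auto simp: spaced_def)
    with ends[of x] y True show ?thesis by (auto simp: c_def)
  next
    case False
    \<comment> \<open>The common point of the two intervals farthest from \<open>y\<close>, hence
      more than \<open>k\<close> away from it.\<close>
    define a where "a = (if y < x then x + k else x + 1)"
    have a: "x < a" "a \<le> x + k" "a \<noteq> y" using False y by (auto simp: a_def)
    have "sum (S x) {a, y} = sum (S (Suc x)) {a, y}"
      using a False y by (intro tie) (auto simp: spaced_def a_def)
    with inner[OF a(1,2)] a(3) show ?thesis by simp
  qed
  have step: "S (Suc x) y - S x y = c x * (of_bool (y = x) - of_bool (y = x + k + 1))" for x y
  proof -
    consider "y = x" | "y = x + k + 1" | "x < y" "y \<le> x + k" | "y < x \<or> x + k + 1 < y"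
      by linarith
    then show ?thesis
    proof cases
      case 1 then show ?thesis by (simp add: c_def)
    next
      case 2 then show ?thesis using ends[of x] by simp
    next
      case 3 then show ?thesis using inner[of x y] by simp
    next
      case 4 then show ?thesis using outer[of y x] by auto
    qed
  qed
  have c_Suc: "c (Suc x) = c x" for x
  proof -
    \<comment> \<open>In the sum of the increments from \<open>x\<close> to \<open>x + 2\<close>
      only \<open>c x\<close> at \<open>x\<close> and \<open>- c (Suc x)\<close> at
      \<open>x + k + 2\<close> survive.\<close>
    have "sum (S x) {x, x + k + 2} = sum (S (x + 2)) {x, x + k + 2}"
      by (intro tie) (auto simp: spaced_def)
    with step[of x x] step[of "Suc x" x] step[of x "x + k + 2"] step[of "Suc x" "x + k + 2"]
    show ?thesis by simp
  qed
  have c_const: "c x = c 0" for x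
    by (induction x) (simp_all add: c_Suc)
  \<comment> \<open>Both terms have the same increments in \<open>x\<close>, so their difference
    depends on \<open>y\<close> alone; divided by \<open>c 0\<close> it becomes
    \<open>h\<close>.\<close>
  have invariant: "c 0 * zero_one_loss k x y - S x y = c 0 * zero_one_loss k 0 y - S 0 y" for x y
  proof (induction x)
    case (Suc x)
    have "zero_one_loss k (Suc x) y - zero_one_loss k x y =
        of_bool (y = x) - of_bool (y = x + k + 1)"
      by (auto simp: zero_one_loss_def of_bool_def)
    then have "c 0 * zero_one_loss k (Suc x) y - c 0 * zero_one_loss k x y = S (Suc x) y - S x y"
      by (metis c_const step right_diff_distrib)
    with Suc show ?case by linarith
  qed simp
  define h where "h y = zero_one_loss k 0 y - S 0 y / c 0" for y
  have "integrable (measure_pmf F) h" if "F \<in> \<F>" for F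
  proof -
    have "integrable (measure_pmf F) (zero_one_loss k 0)"
      by (intro measure_pmf.integrable_const_bound[where B = 1])
        (auto simp: zero_one_loss_def of_bool_def)
    moreover have "integrable (measure_pmf F) (S 0)"
      using assms(2) that by (simp add: scoring_function_def class_integrable_def)
    ultimately show ?thesis unfolding h_def by simp
  qed
  moreover have "zero_one_loss k x y = 1 / c 0 * S x y + h y" for x y
    using invariant[of x y] c_pos[of 0] by (simp add: h_def field_simps)
  ultimately show ?thesis
    using c_pos[of 0] unfolding equivalent_scores_def class_integrable_def
    by (intro exI[of _ "1 / c 0"] conjI exI[of _ h]) auto
qed

end
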